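(* Let $t>1$ be a real number, and let $\mathcal{P}$ be a set of primes satisfying the inequality $$\sum_{p\in\mathcal{P}}p^{-t}\le 1+\bigg(1-\sum_{p\in\mathcal{P}}p^{-2t}\bigg)^{1/2}.$$ Then for every natural number $k$, the set $\mathbb{N}_k(\mathcal{P})$ is $t$-best among primitive subsets of $\mathbb{N}_{\ge k}(\mathcal{P})$; that is, for every natural number $k$ and every primitive set $\mathcal{S}\subset\mathbb{N}_{\ge k}(\mathcal{P})$, $$\sum_{n\in\mathcal{S}}n^{-t}\le\sum_{n\in\mathbb{N}_k(\mathcal{P})}n^{-t}.$$
   Context: $\mathbb{N}=\{1,2,3,\dots\}$; natural numbers $k$ satisfy $k\ge1$. For a set $\mathcal{P}$ of primes (finite or infinite), $\mathbb{N}(\mathcal{P})$ is the set of natural numbers all of whose prime factors lie in $\mathcal{P}$. $\Omega(n)$ is the number of prime factors of $n$ counted with multiplicity. $\mathbb{N}_k(\mathcal{P})=\{n\in\mathbb{N}(\mathcal{P}):\Omega(n)=k\}$ and $\mathbb{N}_{\ge k}(\mathcal{P})=\{n\in\mathbb{N}(\mathcal{P}):\Omega(n)\ge k\}$. A nonempty set of natural numbers is called primitive if no element of the set divides another (distinct) element; by convention the singleton $\{1\}$ is not primitive. The square root is well defined because $\sum_{p}p^{-2}<1$ over all primes. *)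

theory Defs
  imports "HOL-Analysis.Analysis" "HOL-Computational_Algebra.Primes"
begin

definition big_Omega :: "nat \<Rightarrow> nat" where
  "big_Omega n = size (prime_factorization n)"

(* 0 has to be excluded explicitly, since prime_factorization 0 is empty. *)
definition Nats_over :: "nat set \<Rightarrow> nat set" where
  "Nats_over P = {n. n \<ge> 1 \<and> prime_factors n \<subseteq> P}"

definition Nats_eq :: "nat \<Rightarrow> nat set \<Rightarrow> nat set" where
  "Nats_eq k P = {n \<in> Nats_over P. big_Omega n = k}"

definition Nats_ge :: "nat \<Rightarrow> nat set \<Rightarrow> nat set" where
  "Nats_ge k P = {n \<in> Nats_over P. big_Omega n \<ge> k}"

(* By convention neither the empty set nor {1} is primitive. *)
definition primitive_set :: "nat set \<Rightarrow> bool" where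
  "primitive_set S \<longleftrightarrow> S \<noteq> {} \<and> S \<noteq> {1} \<and> 0 \<notin> S \<and>
     (\<forall>a\<in>S. \<forall>b\<in>S. a dvd b \<longrightarrow> a = b)"

(* infsum is 0 on non-summable families; for t > 1 the family is summable on
   every S, so the value is then the genuine sum. *)
definition power_sum :: "real \<Rightarrow> nat set \<Rightarrow> real" where
  "power_sum t S = (\<Sum>\<^sub>\<infinity>n\<in>S. real n powr (- t))"

end

theory Submission
  imports Defs
begin

text \<open>
  Write \<open>x\<^sub>p = p\<^sup>-\<^sup>t\<close>, and let the weight of a set be the sum of \<open>n\<^sup>-\<^sup>t\<close> over its elements.
  The proof pushes a primitive set down to level \<open>k\<close> one level at a time, where the level of
  \<open>n\<close> is \<open>\<Omega>(n)\<close>.  If the elements of maximal level \<open>m > k\<close> form the set \<open>A\<close>, replace them by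
  their shadow, the set of all \<open>n / p\<close> with \<open>n \<in> A\<close> and \<open>p\<close> a prime factor of \<open>n\<close>.  The shadow is
  disjoint from the rest of the set, because the set is primitive, and the new set is again
  primitive.  So everything rests on the inequality that the weight of \<open>A\<close> is at most the weight
  of its shadow (\<open>weight_le_weight_shadow\<close>).

  Count each pair of \<open>n \<in> A\<close> and a prime \<open>p\<close> dividing \<open>n\<close> with multiplicity \<open>v\<^sub>p(n)\<close>.  These
  multiplicities add up to \<open>m\<close> for each \<open>n\<close>, and \<open>n = dp\<close> with \<open>d\<close> in the shadow, so
  \[ m \sum_{n \in A} n^{-t} \le \sum_{d} d^{-t} \sum_p (v_p(d) + 1) x_p . \]
  The hypothesis gives \<open>\<Sum> x\<^sub>p \<le> 2\<close>, and \<open>x\<^sub>p \<le> 1/2\<close> since \<open>t > 1\<close>.  Hence the inner sum is at most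
  \<open>2 + (m - 1)/2\<close>, which is at most \<open>m\<close> as soon as \<open>m \<ge> 3\<close>.  For \<open>m = 2\<close> the shadow is the set
  \<open>V\<close> of primes dividing some element of \<open>A\<close>, and the right-hand side is
  \<open>(\<Sum> x\<^sub>p)\<^sup>2 + \<Sum> x\<^sub>p\<^sup>2\<close> with sums over \<open>V\<close>; the hypothesis passes to subsets
  of \<open>P\<close>, and for \<open>V\<close> it says exactly that this is at most \<open>2 \<Sum> x\<^sub>p\<close>.  Infinite primitive sets are handled through their finite subsets.
\<close>

section \<open>Prime factors counted with multiplicity\<close>

lemma big_Omega_mult:
  assumes "a \<noteq> 0" "b \<noteq> 0"
  shows "big_Omega (a * b) = big_Omega a + big_Omega b"
  using assms by (simp add: big_Omega_def prime_factorization_mult)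

lemma big_Omega_prime: "prime p \<Longrightarrow> big_Omega p = 1"
  by (simp add: big_Omega_def prime_factorization_prime)

lemma big_Omega_eq_0_iff: "n \<noteq> 0 \<Longrightarrow> big_Omega n = 0 \<longleftrightarrow> n = 1"
  by (auto simp: big_Omega_def prime_factorization_empty_iff)

lemma prime_if_big_Omega_eq_1:
  assumes "n \<noteq> 0" "big_Omega n = 1"
  shows "prime n"
proof -
  have "n \<noteq> 1"
    using assms by (auto simp: big_Omega_def)
  then obtain p where p: "prime p" "p dvd n"
    using prime_factor_nat by blast
  then obtain d where d: "n = p * d"
    by (auto elim: dvdE)
  then have "d \<noteq> 0" "p \<noteq> 0"
    using assms(1) by auto
  then have "big_Omega d = 0"
    using assms(2) d big_Omega_mult[of p d] big_Omega_prime[OF p(1)] by simp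
  then have "d = 1"
    using \<open>d \<noteq> 0\<close> by (simp add: big_Omega_eq_0_iff)
  then show ?thesis
    using d p by simp
qed

lemma dvd_imp_eq_if_big_Omega_le:
  assumes "a dvd b" "b \<noteq> 0" "big_Omega b \<le> big_Omega a"
  shows "a = b"
proof -
  obtain c where c: "b = a * c"
    using assms(1) by (auto elim: dvdE)
  then have "a \<noteq> 0" "c \<noteq> 0"
    using assms(2) by auto
  then have "big_Omega c = 0"
    using assms(3) c big_Omega_mult[of a c] by simp
  then have "c = 1"
    using \<open>c \<noteq> 0\<close> by (simp add: big_Omega_eq_0_iff)
  then show ?thesis
    using c by simp
qed

lemma sum_multiplicity_eq_big_Omega:
  assumes "finite V" "prime_factors n \<subseteq> V" "\<And>p. p \<in> V \<Longrightarrow> prime p"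
  shows "(\<Sum>p\<in>V. multiplicity p n) = big_Omega n"
proof -
  have "big_Omega n = (\<Sum>p\<in>prime_factors n. count (prime_factorization n) p)"
    by (simp add: big_Omega_def size_multiset_overloaded_eq)
  also have "\<dots> = (\<Sum>p\<in>V. count (prime_factorization n) p)"
    using assms(1,2) by (intro sum.mono_neutral_left) (auto simp: not_in_iff)
  also have "\<dots> = (\<Sum>p\<in>V. multiplicity p n)"
    using assms(3) by (intro sum.cong) (auto simp: count_prime_factorization_prime)
  finally show ?thesis
    by simp
qed

section \<open>Shadows and the double counting inequality\<close>

definition shadow :: "nat set \<Rightarrow> nat set" where
  "shadow A = {d. \<exists>p. prime p \<and> d * p \<in> A}"

definition prime_support :: "nat set \<Rightarrow> nat set" where
  "prime_support A = (\<Union>n\<in>A. prime_factors n)"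

lemma finite_prime_support: "finite A \<Longrightarrow> finite (prime_support A)"
  by (simp add: prime_support_def)

lemma prime_if_in_prime_support: "p \<in> prime_support A \<Longrightarrow> prime p"
  by (auto simp: prime_support_def)

lemma finite_shadow:
  assumes "finite A" "0 \<notin> A"
  shows "finite (shadow A)"
proof (rule finite_subset)
  show "shadow A \<subseteq> (\<Union>n\<in>A. {d. d dvd n})"
    by (auto simp: shadow_def)
  show "finite (\<Union>n\<in>A. {d. d dvd n})"
    using assms by (intro finite_UN_I finite_divisors_nat) (auto intro: gr0I)
qed

lemma shadow_subset_Nats_eq:
  assumes "A \<subseteq> Nats_eq (Suc m) P"
  shows "shadow A \<subseteq> Nats_eq m P"
proof
  fix d assume "d \<in> shadow A"
  then obtain p where p: "prime p" "d * p \<in> Nats_eq (Suc m) P"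
    using assms by (auto simp: shadow_def)
  then have d0: "d \<noteq> 0" and p0: "p \<noteq> 0"
    by (auto simp: Nats_eq_def Nats_over_def)
  then show "d \<in> Nats_eq m P"
    using p by (auto simp: Nats_eq_def Nats_over_def big_Omega_mult big_Omega_prime
        prime_factorization_mult)
qed

text \<open>
  Each \<open>n \<in> A\<close> occurs on the right once for every prime factor \<open>p\<close>, as \<open>n = dp\<close>, with coefficient
  \<open>v\<^sub>p(d) + 1 = v\<^sub>p(n)\<close>; these coefficients add up to \<open>m\<close>.  Equality can fail because a
  product \<open>dp\<close> need not belong to \<open>A\<close>.
\<close>

lemma double_counting:
  fixes t :: real
  assumes fin: "finite A" and A: "A \<subseteq> Nats_eq m P"
  shows "real m * (\<Sum>n\<in>A. real n powr -t)
           \<le> (\<Sum>d\<in>shadow A. real d powr -t *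
                (\<Sum>p\<in>prime_support A. real (multiplicity p d + 1) * real p powr -t))"
proof -
  define V where "V = prime_support A"
  have V: "finite V" "\<And>p. p \<in> V \<Longrightarrow> prime p"
    using fin by (auto simp: V_def finite_prime_support prime_if_in_prime_support)
  have A0: "n \<noteq> 0" "big_Omega n = m" "prime_factors n \<subseteq> V" if "n \<in> A" for n
    using that A by (auto simp: Nats_eq_def Nats_over_def V_def prime_support_def)
  have finD: "finite (shadow A)"
    using fin A0(1) by (intro finite_shadow) blast+
  have D0: "d \<noteq> 0" if d: "d \<in> shadow A" for d
  proof -
    obtain p where "d * p \<in> A"
      using d by (auto simp: shadow_def)
    then show ?thesis
      using A0(1) by fastforce
  qed
  have fibre: "(\<Sum>n\<in>A. real (multiplicity p n) * real n powr -t)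
                 \<le> (\<Sum>d\<in>shadow A. real (multiplicity p (d * p)) * real (d * p) powr -t)"
    if p: "p \<in> V" for p
  proof -
    have pp: "prime p" and p0: "p \<noteq> 0"
      using V(2)[OF p] by auto
    have inj: "inj_on (\<lambda>d. d * p) (shadow A)"
      using p0 by (auto simp: inj_on_def)
    have "(\<Sum>n\<in>A. real (multiplicity p n) * real n powr -t)
            = (\<Sum>n\<in>{n\<in>A. p dvd n}. real (multiplicity p n) * real n powr -t)"
      using fin by (intro sum.mono_neutral_right) (auto simp: not_dvd_imp_multiplicity_0)
    also have "\<dots> \<le> (\<Sum>n\<in>(\<lambda>d. d * p) ` shadow A. real (multiplicity p n) * real n powr -t)"
    proof (rule sum_mono2)
      show "{n \<in> A. p dvd n} \<subseteq> (\<lambda>d. d * p) ` shadow A"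
        using pp by (auto simp: shadow_def image_iff mult.commute elim!: dvdE)
    qed (use finD in auto)
    also have "\<dots> = (\<Sum>d\<in>shadow A. real (multiplicity p (d * p)) * real (d * p) powr -t)"
      by (simp add: sum.reindex[OF inj])
    finally show ?thesis .
  qed
  have "real m * (\<Sum>n\<in>A. real n powr -t)
          = (\<Sum>n\<in>A. (\<Sum>p\<in>V. real (multiplicity p n) * real n powr -t))"
  proof -
    have "(\<Sum>p\<in>V. real (multiplicity p n)) = real m" if "n \<in> A" for n
      using sum_multiplicity_eq_big_Omega[OF V(1) A0(3)[OF that] V(2)] A0(2)[OF that]
      by (metis of_nat_sum)
    then show ?thesis
      by (simp add: sum_distrib_left sum_distrib_right[symmetric])
  qed
  also have "\<dots> = (\<Sum>p\<in>V. \<Sum>n\<in>A. real (multiplicity p n) * real n powr -t)"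
    by (rule sum.swap)
  also have "\<dots> \<le> (\<Sum>p\<in>V. \<Sum>d\<in>shadow A. real (multiplicity p (d * p)) * real (d * p) powr -t)"
    by (rule sum_mono) (rule fibre)
  also have "\<dots> = (\<Sum>p\<in>V. \<Sum>d\<in>shadow A.
                      real d powr -t * (real (multiplicity p d + 1) * real p powr -t))"
  proof (intro sum.cong refl)
    fix p d assume "p \<in> V" "d \<in> shadow A"
    then have "prime p" "d \<noteq> 0"
      using V(2) D0 by auto
    then have "multiplicity p (d * p) = multiplicity p d + 1"
      by (subst prime_elem_multiplicity_mult_distrib) (auto simp: prime_gt_0_nat)
    then show "real (multiplicity p (d * p)) * real (d * p) powr -t
                 = real d powr -t * (real (multiplicity p d + 1) * real p powr -t)"
      by (simp add: powr_mult)
  qed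
  also have "\<dots> = (\<Sum>d\<in>shadow A. real d powr -t *
                (\<Sum>p\<in>V. real (multiplicity p d + 1) * real p powr -t))"
    by (subst sum.swap) (simp add: sum_distrib_left)
  finally show ?thesis
    by (simp add: V_def)
qed

section \<open>A set weighs at most as much as its shadow\<close>

lemma prime_powr_le_half:
  fixes t :: real
  assumes "t > 1" "prime p"
  shows "real p powr -t \<le> 1 / 2"
proof -
  have "real p \<ge> 2"
    using prime_ge_2_nat[OF assms(2)] by simp
  then have "real p powr -t \<le> real p powr -1"
    using assms(1) by (intro powr_mono) auto
  also have "\<dots> \<le> 1 / 2"
    using \<open>real p \<ge> 2\<close> by (simp add: powr_minus field_simps)
  finally show ?thesis .
qed

text \<open>
  The two bounds on finite sets \<open>V\<close> of primes in the assumptions say, with \<open>x\<^sub>p = p\<^sup>-\<^sup>t\<close>, that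
  \<open>\<Sum> x\<^sub>p \<le> 2\<close> and that the products of two primes of \<open>V\<close> weigh at most as much as \<open>V\<close>, since
  that weight is \<open>((\<Sum> x\<^sub>p)\<^sup>2 + \<Sum> x\<^sub>p\<^sup>2) / 2\<close>.  Level two is treated apart because there the
  bound \<open>\<Sum> (v\<^sub>p(d) + 1) x\<^sub>p \<le> m\<close> may fail for a single prime \<open>d\<close>; it is only true on average.
\<close>

lemma weight_le_weight_shadow:
  fixes t :: real
  assumes t: "t > 1" and m: "m \<ge> 2"
    and fin: "finite A" and A: "A \<subseteq> Nats_eq m P"
    and le2: "\<And>V. finite V \<Longrightarrow> V \<subseteq> P \<Longrightarrow> (\<Sum>p\<in>V. real p powr -t) \<le> 2"
    and pairs: "\<And>V. finite V \<Longrightarrow> V \<subseteq> P \<Longrightarrow>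
      (\<Sum>p\<in>V. real p powr -t)\<^sup>2 + (\<Sum>p\<in>V. (real p powr -t)\<^sup>2) \<le> 2 * (\<Sum>p\<in>V. real p powr -t)"
  shows "(\<Sum>n\<in>A. real n powr -t) \<le> (\<Sum>d\<in>shadow A. real d powr -t)"
proof -
  define V where "V = prime_support A"
  define x where "x p = real p powr -t" for p
  have V: "finite V" "V \<subseteq> P" "\<And>p. p \<in> V \<Longrightarrow> prime p"
    using fin A by (auto simp: V_def finite_prime_support prime_if_in_prime_support)
      (auto simp: prime_support_def Nats_eq_def Nats_over_def)
  have DV: "shadow A \<subseteq> Nats_eq (m - 1) V"
  proof (rule shadow_subset_Nats_eq)
    show "A \<subseteq> Nats_eq (Suc (m - 1)) V"
      using m A by (auto simp: V_def prime_support_def Nats_eq_def Nats_over_def)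
  qed
  have "real m * (\<Sum>n\<in>A. x n)
          \<le> (\<Sum>d\<in>shadow A. x d * (\<Sum>p\<in>V. real (multiplicity p d + 1) * x p))"
    using double_counting[OF fin A, of t] by (simp add: V_def x_def)
  also have "\<dots> \<le> real m * (\<Sum>d\<in>shadow A. x d)"
  proof (cases "m = 2")
    case True
    have D1: "d \<in> V \<and> prime d" if "d \<in> shadow A" for d
    proof -
      have "d \<noteq> 0" "big_Omega d = 1" "prime_factors d \<subseteq> V"
        using that DV True by (auto simp: Nats_eq_def Nats_over_def)
      then show ?thesis
        using prime_if_big_Omega_eq_1[of d] by (auto simp: prime_factorization_prime)
    qed
    have "V \<subseteq> shadow A"
    proof
      fix p assume "p \<in> V"
      then obtain n where n: "n \<in> A" "prime p" "p dvd n"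
        by (auto simp: V_def prime_support_def)
      then obtain q where q: "n = p * q"
        by (auto elim: dvdE)
      have n2: "n \<noteq> 0" "big_Omega n = 2"
        using n(1) A True by (auto simp: Nats_eq_def Nats_over_def)
      then have "q \<noteq> 0" "big_Omega q = 1"
        using q n(2) big_Omega_mult[of p q] big_Omega_prime[of p] by auto
      then show "p \<in> shadow A"
        using n(1) q prime_if_big_Omega_eq_1 by (auto simp: shadow_def)
    qed
    then have D: "shadow A = V"
      using D1 by blast
    have "(\<Sum>p\<in>V. real (multiplicity p q + 1) * x p) = (\<Sum>p\<in>V. x p) + x q" if q: "q \<in> V" for q
    proof -
      have "(\<Sum>p\<in>V. real (multiplicity p q + 1) * x p) = (\<Sum>p\<in>V. x p + (if p = q then x p else 0))"
        using q V(3) by (intro sum.cong) (auto simp: prime_multiplicity_other)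
      then show ?thesis
        using q V(1) by (simp add: sum.distrib)
    qed
    then have "(\<Sum>d\<in>shadow A. x d * (\<Sum>p\<in>V. real (multiplicity p d + 1) * x p))
            = (\<Sum>p\<in>V. x p)\<^sup>2 + (\<Sum>p\<in>V. (x p)\<^sup>2)"
      by (simp add: D distrib_left sum.distrib sum_distrib_right[symmetric] power2_eq_square)
    also have "\<dots> \<le> 2 * (\<Sum>p\<in>V. x p)"
      using pairs[OF V(1,2)] by (simp add: x_def)
    finally show ?thesis
      using True D by simp
  next
    case False
    then have m3: "m \<ge> 3"
      using m by simp
    have inner: "(\<Sum>p\<in>V. real (multiplicity p d + 1) * x p) \<le> real m" if d: "d \<in> shadow A" for d
    proof -
      have "prime_factors d \<subseteq> V" "big_Omega d = m - 1"
        using d DV by (auto simp: Nats_eq_def Nats_over_def)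
      then have mult: "(\<Sum>p\<in>V. real (multiplicity p d)) = real (m - 1)"
        using sum_multiplicity_eq_big_Omega[OF V(1) _ V(3)] by (metis of_nat_sum)
      have "(\<Sum>p\<in>V. real (multiplicity p d) * x p) \<le> (\<Sum>p\<in>V. real (multiplicity p d) * (1 / 2))"
        using prime_powr_le_half[OF t V(3)] by (intro sum_mono mult_left_mono) (auto simp: x_def)
      also have "\<dots> = real (m - 1) / 2"
        using mult by (simp add: sum_divide_distrib[symmetric])
      finally have "(\<Sum>p\<in>V. real (multiplicity p d + 1) * x p) \<le> real (m - 1) / 2 + (\<Sum>p\<in>V. x p)"
        by (simp add: distrib_right sum.distrib)
      also have "\<dots> \<le> real (m - 1) / 2 + 2"
        using le2[OF V(1,2)] by (simp add: x_def)
      also have "\<dots> \<le> real m"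
        using m3 by (simp add: of_nat_diff field_simps)
      finally show ?thesis .
    qed
    have "(\<Sum>d\<in>shadow A. x d * (\<Sum>p\<in>V. real (multiplicity p d + 1) * x p))
            \<le> (\<Sum>d\<in>shadow A. x d * real m)"
      by (intro sum_mono mult_left_mono inner) (auto simp: x_def)
    also have "\<dots> = real m * (\<Sum>d\<in>shadow A. x d)"
      by (simp add: sum_distrib_left mult.commute)
    finally show ?thesis .
  qed
  finally show ?thesis
    using m by (simp add: x_def)
qed

section \<open>Pushing a finite antichain down to the lowest level\<close>

text \<open>
  One step replaces the top level by its shadow.  Primitivity enters twice: it keeps the shadow
  disjoint from the lower levels, so that no weight is lost in the union, and it makes the new set
  an antichain, because a divisor of \<open>d\<close> is also a divisor of each \<open>dp\<close>.
\<close>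

lemma antichain_weight_le_level:
  fixes t :: real
  assumes shadow_le: "\<And>m A. m \<ge> 2 \<Longrightarrow> finite A \<Longrightarrow> A \<subseteq> Nats_eq m P \<Longrightarrow>
      (\<Sum>n\<in>A. real n powr -t) \<le> (\<Sum>d\<in>shadow A. real d powr -t)"
    and k: "k \<ge> 1"
    and "finite S" "S \<subseteq> Nats_ge k P"
    and "\<And>n. n \<in> S \<Longrightarrow> big_Omega n \<le> k + j"
    and "\<And>a b. a \<in> S \<Longrightarrow> b \<in> S \<Longrightarrow> a dvd b \<Longrightarrow> a = b"
  shows "\<exists>T. finite T \<and> T \<subseteq> Nats_eq k P \<and> (\<Sum>n\<in>S. real n powr -t) \<le> (\<Sum>n\<in>T. real n powr -t)"
  using assms(3-)
proof (induction j arbitrary: S)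
  case 0
  then have "S \<subseteq> Nats_eq k P"
    by (force simp: Nats_eq_def Nats_ge_def)
  then show ?case
    using 0 by blast
next
  case (Suc j)
  define A where "A = {n\<in>S. big_Omega n = Suc (k + j)}"
  define L where "L = S - A"
  define S' where "S' = L \<union> shadow A"
  have A: "A \<subseteq> S" "finite A" "A \<subseteq> Nats_eq (Suc (k + j)) P"
    using Suc.prems by (auto simp: A_def Nats_eq_def Nats_ge_def)
  have S0: "n \<noteq> 0" if "n \<in> S" for n
    using that Suc.prems(2) by (auto simp: Nats_ge_def Nats_over_def)
  have D: "shadow A \<subseteq> Nats_eq (k + j) P"
    by (rule shadow_subset_Nats_eq[OF A(3)])
  have finD: "finite (shadow A)"
    using A S0 by (intro finite_shadow) auto
  have L_le: "big_Omega n \<le> k + j" if "n \<in> L" for n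
    using that Suc.prems(3)[of n] by (auto simp: L_def A_def)
  have disj: "L \<inter> shadow A = {}"
  proof (rule ccontr)
    assume "L \<inter> shadow A \<noteq> {}"
    then obtain d p where d: "d \<in> S" "prime p" "d * p \<in> S"
      using A(1) by (auto simp: L_def shadow_def)
    then have "d = d * p"
      using Suc.prems(4) by simp
    then show False
      using S0[OF d(1)] d(2) by auto
  qed
  have "(\<Sum>n\<in>S. real n powr -t) = (\<Sum>n\<in>L. real n powr -t) + (\<Sum>n\<in>A. real n powr -t)"
    using A(1) Suc.prems(1) by (simp add: L_def sum.subset_diff)
  also have "\<dots> \<le> (\<Sum>n\<in>L. real n powr -t) + (\<Sum>d\<in>shadow A. real d powr -t)"
    using shadow_le[OF _ A(2,3)] k by simp
  also have "\<dots> = (\<Sum>n\<in>S'. real n powr -t)"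
    using disj finD Suc.prems(1) by (simp add: S'_def L_def sum.union_disjoint)
  finally have weight: "(\<Sum>n\<in>S. real n powr -t) \<le> (\<Sum>n\<in>S'. real n powr -t)" .
  have S'_le: "big_Omega n \<le> k + j" "n \<noteq> 0" if "n \<in> S'" for n
    using that L_le D S0 by (auto simp: S'_def Nats_eq_def Nats_over_def L_def)
  have "\<exists>T. finite T \<and> T \<subseteq> Nats_eq k P \<and> (\<Sum>n\<in>S'. real n powr -t) \<le> (\<Sum>n\<in>T. real n powr -t)"
  proof (rule Suc.IH)
    show "finite S'"
      using finD Suc.prems(1) by (simp add: S'_def L_def)
    show "S' \<subseteq> Nats_ge k P"
      using D Suc.prems(2) by (auto simp: S'_def L_def Nats_ge_def Nats_eq_def)
    show "big_Omega n \<le> k + j" if "n \<in> S'" for n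
      using S'_le that by blast
    fix a b assume ab: "a \<in> S'" "b \<in> S'" "a dvd b"
    show "a = b"
    proof (cases "a \<in> shadow A")
      case True
      then have "big_Omega a = k + j"
        using D by (auto simp: Nats_eq_def)
      then show ?thesis
        using S'_le[OF ab(2)] ab(3) by (intro dvd_imp_eq_if_big_Omega_le) auto
    next
      case False
      then have a: "a \<in> L" "a \<in> S" "a \<notin> A"
        using ab(1) by (auto simp: S'_def L_def)
      show ?thesis
      proof (cases "b \<in> shadow A")
        case True
        then obtain p where "b * p \<in> A"
          by (auto simp: shadow_def)
        moreover from this have "a = b * p"
          using a(2) A(1) ab(3) Suc.prems(4) by auto
        ultimately show ?thesis
          using a(3) by simp
      next
        case False
        then show ?thesis
          using ab a Suc.prems(4) by (auto simp: S'_def L_def)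
      qed
    qed
  qed
  then show ?case
    using weight by (meson order_trans)
qed

section \<open>From the hypothesis to finite sets of primes\<close>

lemma summable_on_nat_powr:
  fixes t :: real
  assumes "t > 1"
  shows "(\<lambda>n. real n powr -t) summable_on S"
proof -
  have "(\<lambda>n. real n powr -t) summable_on UNIV"
    using assms summable_real_powr_iff[of "-t"] by (intro norm_summable_imp_summable_on) simp
  then show ?thesis
    by (rule summable_on_subset_banach) simp
qed

text \<open>
  With \<open>s\<close> and \<open>q\<close> the sums of \<open>x\<^sub>p\<close> and \<open>x\<^sub>p\<^sup>2\<close>, the condition \<open>s \<le> 1 + \<surd>(1 - q)\<close> amounts to
  \<open>s\<^sup>2 + q \<le> 2s\<close>: square it when \<open>s > 1\<close>, and note that for \<open>s \<le> 1\<close> the latter always holds,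
  because \<open>q \<le> s\<close>.  It passes to subsets, because \<open>s\<close> decreases and \<open>1 - q\<close> increases there.
\<close>

lemma sum_primes_bounds:
  fixes t :: real
  assumes t: "t > 1"
    and P: "\<And>p. p \<in> P \<Longrightarrow> prime p"
    and hyp: "power_sum t P \<le> 1 + sqrt (1 - power_sum (2 * t) P)"
    and V: "finite V" "V \<subseteq> P"
  shows "(\<Sum>p\<in>V. real p powr -t) \<le> 2"
    and "(\<Sum>p\<in>V. real p powr -t)\<^sup>2 + (\<Sum>p\<in>V. (real p powr -t)\<^sup>2) \<le> 2 * (\<Sum>p\<in>V. real p powr -t)"
proof -
  define s where "s = (\<Sum>p\<in>V. real p powr -t)"
  define q where "q = (\<Sum>p\<in>V. (real p powr -t)\<^sup>2)"
  have sq: "(real p powr -t)\<^sup>2 = real p powr -(2 * t)" for p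
    by (simp add: power2_eq_square powr_add[symmetric])
  have s0: "0 \<le> s" and q0: "0 \<le> q"
    by (auto simp: s_def q_def intro: sum_nonneg)
  have "s \<le> power_sum t P"
    unfolding s_def power_sum_def
    by (intro finite_sum_le_infsum summable_on_nat_powr V t) auto
  moreover have "q \<le> power_sum (2 * t) P"
    unfolding q_def sq power_sum_def
    using t by (intro finite_sum_le_infsum summable_on_nat_powr V) auto
  ultimately have s_le: "s \<le> 1 + sqrt (1 - q)"
    using hyp by (smt (verit) real_sqrt_le_mono)
  have "sqrt (1 - q) \<le> 1"
    using q0 by simp
  then have "s \<le> 2"
    using s_le by linarith
  then show "(\<Sum>p\<in>V. real p powr -t) \<le> 2"
    by (simp add: s_def)
  have "s\<^sup>2 + q \<le> 2 * s"
  proof (cases "s \<le> 1")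
    case True
    have "q \<le> s"
      unfolding q_def s_def
    proof (rule sum_mono)
      fix p assume "p \<in> V"
      then have "real p powr -t \<le> 1 / 2"
        using V P prime_powr_le_half[OF t] by blast
      then show "(real p powr -t)\<^sup>2 \<le> real p powr -t"
        by (simp add: power2_eq_square mult_left_le)
    qed
    moreover have "s\<^sup>2 \<le> s"
      using True s0 by (simp add: power2_eq_square mult_left_le)
    ultimately show ?thesis
      by simp
  next
    \<comment> \<open>Here the root is positive, so its argument is too, and squaring is legitimate.\<close>
    case False
    then have "0 < sqrt (1 - q)" "s - 1 \<le> sqrt (1 - q)" "0 \<le> s - 1"
      using s_le by linarith+
    then have "(s - 1)\<^sup>2 \<le> 1 - q"
      by (metis power_mono real_sqrt_gt_0_iff real_sqrt_pow2 less_imp_le)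
    then show ?thesis
      by (simp add: power2_eq_square algebra_simps)
  qed
  then show "(\<Sum>p\<in>V. real p powr -t)\<^sup>2 + (\<Sum>p\<in>V. (real p powr -t)\<^sup>2)
      \<le> 2 * (\<Sum>p\<in>V. real p powr -t)"
    by (simp add: s_def q_def)
qed

theorem theorem6:
  fixes t :: real and P :: "nat set"
  assumes "t > 1"
    and "\<And>p. p \<in> P \<Longrightarrow> prime p"
    and "power_sum t P \<le> 1 + sqrt (1 - power_sum (2 * t) P)"
  shows "\<forall>k::nat. k \<ge> 1 \<longrightarrow>
           (\<forall>S. primitive_set S \<and> S \<subseteq> Nats_ge k P \<longrightarrow>
              power_sum t S \<le> power_sum t (Nats_eq k P))"
proof (intro allI impI)
  fix k :: nat and S
  assume k: "k \<ge> 1" and S: "primitive_set S \<and> S \<subseteq> Nats_ge k P"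
  have shadow_le: "(\<Sum>n\<in>A. real n powr -t) \<le> (\<Sum>d\<in>shadow A. real d powr -t)"
    if "m \<ge> 2" "finite A" "A \<subseteq> Nats_eq m P" for m A
    using assms(1) that sum_primes_bounds[OF assms] by (rule weight_le_weight_shadow)
  show "power_sum t S \<le> power_sum t (Nats_eq k P)"
    unfolding power_sum_def
  proof (rule infsum_le_finite_sums[OF summable_on_nat_powr[OF assms(1)]])
    fix F assume F: "finite F" "F \<subseteq> S"
    define j where "j = Max (insert 0 (big_Omega ` F))"
    have "\<exists>T. finite T \<and> T \<subseteq> Nats_eq k P \<and> (\<Sum>n\<in>F. real n powr -t) \<le> (\<Sum>n\<in>T. real n powr -t)"
    proof (rule antichain_weight_le_level[OF shadow_le k F(1)])
      show "F \<subseteq> Nats_ge k P"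
        using F(2) S by blast
      show "big_Omega n \<le> k + j" if "n \<in> F" for n
        using that F(1) by (auto simp: j_def intro!: trans_le_add2 Max_ge)
      show "a = b" if "a \<in> F" "b \<in> F" "a dvd b" for a b
        using that F(2) S by (auto simp: primitive_set_def)
    qed
    then obtain T where T: "finite T" "T \<subseteq> Nats_eq k P"
      "(\<Sum>n\<in>F. real n powr -t) \<le> (\<Sum>n\<in>T. real n powr -t)"
      by blast
    note T(3)
    also have "(\<Sum>n\<in>T. real n powr -t) \<le> (\<Sum>\<^sub>\<infinity>n\<in>Nats_eq k P. real n powr -t)"
      by (intro finite_sum_le_infsum summable_on_nat_powr assms(1) T) auto
    finally show "(\<Sum>n\<in>F. real n powr -t) \<le> (\<Sum>\<^sub>\<infinity>n\<in>Nats_eq k P. real n powr -t)" .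
  qed
qed

end
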